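(* Let $L$ be a semimodular lattice of finite length. Assume that the poset $J(L)$ of join-irreducible elements of $L$ is the union of a set $\{C_i: i\in I\}$ of pairwise set-theoretically disjoint chains. Then $L$ has a length-preserving semimodular extension $K$ such that, for some set $\{C_i': i\in I\}$ of pairwise parallel chains of $J(K)$, we have $J(K)=\bigcup\{C_i': i\in I\}$ and $|C_i'|=|C_i|$ for all $i\in I$.
   Context: For a lattice $M$ of finite length, $J(M)$ is the poset (ordered by the order of $M$) of nonzero join-irreducible elements of $M$, i.e. those having exactly one lower cover. A lattice is semimodular if $a\wedge b\prec a$ implies $b\prec a\vee b$. The length of a chain $C$ is $|C|-1$; the length of a poset is the supremum of the lengths of its chains. A length-preserving semimodular extension of $L$ is a semimodular lattice $K$ of finite length such that $L$ is a sublattice of $K$ and $\mathrm{length}(K)=\mathrm{length}(L)$. Two chains $C_1,C_2$ in a poset are parallel if $x_1\not\leq x_2$ and $x_2\not\leq x_1$ for all $x_1\in C_1$ and $x_2\in C_2$; "pairwise" refers to pairs with distinct indices. *)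

theory Defs
  imports "HOL-Algebra.Lattice" "HOL-Library.Extended_Nat" "HOL-Library.Equipollence"
begin

definition chain_of :: "('a, 'm) gorder_scheme \<Rightarrow> 'a set \<Rightarrow> bool" where
  "chain_of P C \<longleftrightarrow> C \<subseteq> carrier P \<and> Complete_Partial_Order.chain (le P) C"

text \<open>The natural subtraction truncates only at the empty chain, which does not affect the
  supremum.\<close>

definition poset_length :: "('a, 'm) gorder_scheme \<Rightarrow> enat" where
  "poset_length P =
     (SUP C \<in> {C. chain_of P C}. if finite C then enat (card C - 1) else \<infinity>)"

definition finite_length :: "('a, 'm) gorder_scheme \<Rightarrow> bool" where
  "finite_length P \<longleftrightarrow> poset_length P < \<infinity>"

definition covered_by :: "('a, 'm) gorder_scheme \<Rightarrow> 'a \<Rightarrow> 'a \<Rightarrow> bool" where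
  "covered_by P x y \<longleftrightarrow> x \<in> carrier P \<and> y \<in> carrier P \<and> x \<sqsubset>\<^bsub>P\<^esub> y \<and>
     \<not> (\<exists>z \<in> carrier P. x \<sqsubset>\<^bsub>P\<^esub> z \<and> z \<sqsubset>\<^bsub>P\<^esub> y)"

text \<open>The locale \<^locale>\<open>lattice\<close> admits an empty carrier, so nonemptiness is required
  explicitly.\<close>

definition semimodular_lattice :: "('a, 'm) gorder_scheme \<Rightarrow> bool" where
  "semimodular_lattice M \<longleftrightarrow> lattice M \<and> carrier M \<noteq> {} \<and>
     (\<forall>a \<in> carrier M. \<forall>b \<in> carrier M.
        covered_by M (a \<sqinter>\<^bsub>M\<^esub> b) a \<longrightarrow> covered_by M b (a \<squnion>\<^bsub>M\<^esub> b))"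

text \<open>The join-irreducible elements as a poset. Having exactly one lower cover already excludes
  the least element.\<close>

definition J :: "('a, 'm) gorder_scheme \<Rightarrow> ('a, 'm) gorder_scheme" where
  "J M = M\<lparr>carrier := {x \<in> carrier M. \<exists>!y. covered_by M y x}\<rparr>"

definition parallel :: "('a, 'm) gorder_scheme \<Rightarrow> 'a set \<Rightarrow> 'a set \<Rightarrow> bool" where
  "parallel P C D \<longleftrightarrow> (\<forall>x \<in> C. \<forall>y \<in> D. \<not> x \<sqsubseteq>\<^bsub>P\<^esub> y \<and> \<not> y \<sqsubseteq>\<^bsub>P\<^esub> x)"

definition sublattice :: "('a, 'm) gorder_scheme \<Rightarrow> ('a, 'n) gorder_scheme \<Rightarrow> bool" where
  "sublattice L K \<longleftrightarrow> carrier L \<subseteq> carrier K \<and> join_pres L K id \<and> meet_pres L K id"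

definition length_preserving_semimodular_extension ::
  "('a, 'm) gorder_scheme \<Rightarrow> ('a, 'n) gorder_scheme \<Rightarrow> bool" where
  "length_preserving_semimodular_extension L K \<longleftrightarrow>
     semimodular_lattice K \<and> finite_length K \<and> sublattice L K \<and>
     poset_length K = poset_length L"

text \<open>The copy of \<open>L\<close> on \<open>f ` carrier L\<close>, for \<open>f\<close> injective on the carrier. An extension of
  \<open>L\<close> may need more elements than the element type of \<open>L\<close> has, so one passes to the copy of \<open>L\<close>
  under \<^const>\<open>Inl\<close> in \<open>'a + 'a set\<close>. This leaves enough room when \<open>J K\<close> is equipollent to
  \<open>J L\<close>: in a lattice \<open>K\<close> of finite length every element is determined by the set of
  join-irreducibles below it, so \<open>K\<close> has at most as many elements as \<open>'a set\<close>.\<close>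

definition copy :: "('a \<Rightarrow> 'b) \<Rightarrow> ('a, 'm) gorder_scheme \<Rightarrow> 'b gorder" where
  "copy f L = \<lparr>carrier = f ` carrier L, eq = (=),
     le = (\<lambda>u v. \<exists>x \<in> carrier L. \<exists>y \<in> carrier L. u = f x \<and> v = f y \<and> x \<sqsubseteq>\<^bsub>L\<^esub> y)\<rparr>"

end

theory Submission
  imports Defs
begin

text \<open>The extension is built from a submodular rank function, in the way in which a geometric
  lattice is built from a matroid. Forget all comparabilities between join-irreducibles except
  those inside one chain \<open>C i\<close>, and let a downset be a set of join-irreducibles that is an
  order ideal in this weaker order. Writing \<open>below a\<close> for the set of join-irreducibles below \<open>a\<close> and
  \<open>h\<close> for the height in \<open>L\<close>, define the rank of a downset \<open>X\<close> as the minimum of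
  \<open>h a + card (X - below a)\<close> over all \<open>a\<close> with \<open>X - below a\<close> finite. Since \<open>h\<close> is submodular, so is
  this rank (\<open>rk_submodular\<close>); adding one element raises it by at most one. Call a downset closed
  if every larger downset has larger rank. By submodularity the closed downsets form a
  semimodular lattice under inclusion, whose covers are the inclusions that raise the rank by
  one (\<open>semimodular_closed_sets\<close>). Its length is at most \<open>h \<top>\<close>, as no rank exceeds \<open>h \<top>\<close>.

  The map \<open>below\<close> embeds \<open>L\<close> into this lattice. The point is that \<open>below a\<close> has rank \<open>h a\<close> and is
  closed: starting from any \<open>c\<close>, the missing join-irreducibles can be joined to \<open>c\<close> in order of
  increasing height, and each step raises the height by at most one, because the lower cover of
  the new element is already below (\<open>height_le_height_plus_card\<close>). The same estimate for
  \<open>below a \<union> below b\<close> shows that joins are preserved, and the image of a longest chain of \<open>L\<close> shows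
  that the length does not change.

  It remains to find the join-irreducible closed sets. Every initial segment \<open>Z\<close> of a chain \<open>C i\<close>
  is a downset, because no element of \<open>Z\<close> lies in another chain, and it is closed with rank
  \<open>card Z\<close>: a chain of join-irreducibles below \<open>a\<close> that has \<open>h a\<close> elements contains every
  join-irreducible below \<open>a\<close>
  (\<open>chain_below_card_less\<close>), so no \<open>a\<close> can lower the rank of a larger set to \<open>card Z\<close>. A closed set
  is the union of the initial segments generated by its elements, so exactly these segments
  are join-irreducible; those from one chain are ordered as the chain is, and those from
  different chains are disjoint and nonempty, hence incomparable.\<close>

section \<open>Rank functions and cover chains\<close>

locale ranked_order = partial_order L for L (structure) +
  fixes r :: "'a \<Rightarrow> nat" and N :: nat
  assumes rank_le: "x \<in> carrier L \<Longrightarrow> r x \<le> N"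
    and rank_strict: "\<lbrakk>x \<in> carrier L; y \<in> carrier L; x \<sqsubset> y\<rbrakk> \<Longrightarrow> r x < r y"
begin

lemma rank_inj_on_chain:
  assumes "chain_of L C"
  shows "inj_on r C"
proof (rule inj_onI)
  fix x y assume xy: "x \<in> C" "y \<in> C" "r x = r y"
  then have "x \<sqsubseteq> y \<or> y \<sqsubseteq> x" "x \<in> carrier L" "y \<in> carrier L"
    using assms by (auto simp: chain_of_def Complete_Partial_Order.chain_def)
  then show "x = y"
    using rank_strict[of x y] rank_strict[of y x] xy(3) by (auto simp: lless_eq)
qed

lemma chain_finite:
  assumes "chain_of L C"
  shows "finite C" "card C \<le> Suc N"
proof -
  have sub: "r ` C \<subseteq> {..N}" using assms rank_le by (auto simp: chain_of_def)
  then show "finite C"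
    using rank_inj_on_chain[OF assms] by (meson finite_atMost finite_imageD finite_subset)
  have "card C = card (r ` C)" by (simp add: card_image rank_inj_on_chain[OF assms])
  also have "\<dots> \<le> card {..N}" by (rule card_mono) (use sub in auto)
  finally show "card C \<le> Suc N" by simp
qed

lemma poset_length_eq:
  assumes "chain_of L D" "card D = Suc N"
  shows "poset_length L = enat N"
  unfolding poset_length_def
proof (rule antisym)
  show "(SUP C \<in> {C. chain_of L C}. if finite C then enat (card C - 1) else \<infinity>) \<le> enat N"
    by (rule SUP_least) (use chain_finite in fastforce)
  show "enat N \<le> (SUP C \<in> {C. chain_of L C}. if finite C then enat (card C - 1) else \<infinity>)"
    by (rule SUP_upper2[of D]) (use assms chain_finite[of D] in auto)
qed

lemma exists_cover_above:
  assumes "x \<in> carrier L" "y \<in> carrier L" "x \<sqsubset> y"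
  shows "\<exists>z. covered_by L x z \<and> z \<sqsubseteq> y"
proof -
  define P where "P z \<longleftrightarrow> z \<in> carrier L \<and> x \<sqsubset> z \<and> z \<sqsubseteq> y" for z
  have "P y" using assms by (auto simp: P_def)
  then obtain z where z: "P z" and min: "\<And>w. P w \<Longrightarrow> r z \<le> r w"
    using ex_has_least_nat[of P y r] by blast
  have "\<not> (x \<sqsubset> w \<and> w \<sqsubset> z)" if w: "w \<in> carrier L" for w
  proof
    assume "x \<sqsubset> w \<and> w \<sqsubset> z"
    then have "P w" "r w < r z" using w z assms rank_strict[of w z]
      by (auto simp: P_def lless_eq intro: le_trans)
    then show False using min[of w] by simp
  qed
  then show ?thesis using z assms by (auto simp: P_def covered_by_def)
qed

lemma exists_cover_below:
  assumes "x \<in> carrier L" "y \<in> carrier L" "x \<sqsubset> y"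
  shows "\<exists>z. covered_by L z y \<and> x \<sqsubseteq> z"
proof -
  define P where "P z \<longleftrightarrow> z \<in> carrier L \<and> x \<sqsubseteq> z \<and> z \<sqsubset> y" for z
  have "P x" using assms by (auto simp: P_def)
  moreover have "\<forall>z. P z \<longrightarrow> r z < Suc N" using rank_le by (auto simp: P_def less_Suc_eq_le)
  ultimately obtain z where z: "P z" and max: "\<And>w. P w \<Longrightarrow> r w \<le> r z"
    using ex_has_greatest_nat[of P x r "Suc N"] by blast
  have "\<not> (z \<sqsubset> w \<and> w \<sqsubset> y)" if w: "w \<in> carrier L" for w
  proof
    assume "z \<sqsubset> w \<and> w \<sqsubset> y"
    then have "P w" "r z < r w" using w z assms rank_strict[of z w]
      by (auto simp: P_def lless_eq intro: le_trans)
    then show False using max[of w] by simp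
  qed
  then show ?thesis using z assms by (auto simp: P_def covered_by_def)
qed

end

inductive cover_steps :: "('a, 'm) gorder_scheme \<Rightarrow> nat \<Rightarrow> 'a \<Rightarrow> 'a \<Rightarrow> bool" for L where
  refl: "x \<in> carrier L \<Longrightarrow> cover_steps L 0 x x"
| step: "covered_by L x y \<Longrightarrow> cover_steps L n y z \<Longrightarrow> cover_steps L (Suc n) x z"

lemma cover_steps_append:
  assumes "cover_steps L n x y" "covered_by L y z"
  shows "cover_steps L (Suc n) x z"
  using assms
proof (induction rule: cover_steps.induct)
  case (refl x)
  then show ?case by (auto simp: covered_by_def intro!: cover_steps.intros)
next
  case (step x y n w)
  then show ?case by (blast intro: cover_steps.step)
qed

lemma cover_steps_carrier:
  "cover_steps L n x y \<Longrightarrow> x \<in> carrier L \<and> y \<in> carrier L"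
  by (induction rule: cover_steps.induct) (auto simp: covered_by_def)

context partial_order
begin

lemma covered_byD:
  assumes "covered_by L x y"
  shows "x \<in> carrier L" "y \<in> carrier L" "x \<sqsubseteq> y" "x \<noteq> y"
  using assms by (auto simp: covered_by_def lless_eq)

lemma covered_by_between:
  "\<lbrakk>covered_by L x y; z \<in> carrier L; x \<sqsubseteq> z; z \<sqsubseteq> y\<rbrakk> \<Longrightarrow> z = x \<or> z = y"
  by (auto simp: covered_by_def lless_eq)

lemma cover_steps_le:
  "cover_steps L n x y \<Longrightarrow> x \<sqsubseteq> y"
proof (induction rule: cover_steps.induct)
  case (step x y n z)
  then show ?case using covered_byD[OF step(1)] cover_steps_carrier[OF step(2)]
    by (blast intro: le_trans)
qed auto

lemma cover_steps_chain:
  "cover_steps L n x y \<Longrightarrow> \<exists>D. chain_of L D \<and> card D = Suc n \<and> (\<forall>d\<in>D. x \<sqsubseteq> d)"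
proof (induction rule: cover_steps.induct)
  case (refl x)
  then show ?case
    by (intro exI[of _ "{x}"]) (auto simp: chain_of_def Complete_Partial_Order.chain_def)
next
  case (step x y n z)
  note xy = covered_byD[OF step(1)]
  obtain D where D: "chain_of L D" "card D = Suc n" "\<forall>d\<in>D. y \<sqsubseteq> d" using step by blast
  then have Dc: "D \<subseteq> carrier L" by (simp add: chain_of_def)
  have le: "x \<sqsubseteq> d" if "d \<in> D" for d using that D xy Dc by (meson le_trans subsetD)
  have "x \<notin> D" using D xy by blast
  moreover have "finite D" using D(2) card_ge_0_finite by force
  ultimately have "card (insert x D) = Suc (Suc n)" using D by simp
  moreover have "chain_of L (insert x D)"
    using D(1) le xy(1) by (auto simp: chain_of_def Complete_Partial_Order.chain_def)
  ultimately show ?case using le xy(1) by (intro exI[of _ "insert x D"]) auto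
qed

lemma join_eqI: "least L s (Upper L {x, y}) \<Longrightarrow> x \<squnion> y = s"
  unfolding join_def Lattice.sup_def by (blast intro: least_unique)

lemma meet_eqI: "greatest L s (Lower L {x, y}) \<Longrightarrow> x \<sqinter> y = s"
  unfolding meet_def Lattice.inf_def by (blast intro: greatest_unique)

text \<open>The rank of \<open>x\<close> is the cardinality of a longest chain below \<open>x\<close>. It turns searches for
  minimal elements and for covers into searches for least numbers.\<close>

lemma finite_length_ranked:
  assumes "finite_length L"
  shows "\<exists>r N. ranked_order L r N"
proof -
  obtain N where N: "poset_length L = enat N"
    using assms by (auto simp: finite_length_def less_infinityE)
  have bound: "finite C \<and> card C \<le> Suc N" if "chain_of L C" for C
  proof -
    have "(if finite C then enat (card C - 1) else \<infinity>) \<le> enat N"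
      unfolding N[symmetric] poset_length_def by (rule SUP_upper) (use that in simp)
    then show ?thesis by (auto split: if_splits)
  qed
  define P where "P x n \<longleftrightarrow> (\<exists>C. chain_of L C \<and> (\<forall>y\<in>C. y \<sqsubseteq> x) \<and> card C = n)" for x n
  define r where "r x = Greatest (P x)" for x
  have P0: "P x 0" for x
    unfolding P_def by (intro exI[of _ "{}"]) (auto simp: chain_of_def Complete_Partial_Order.chain_def)
  have Ple: "n \<le> Suc N" if "P x n" for x n using that bound by (auto simp: P_def)
  have Pr: "P x (r x)" for x unfolding r_def using P0 Ple by (rule GreatestI_nat)
  have le_r: "n \<le> r x" if "P x n" for x n unfolding r_def using that Ple by (rule Greatest_le_nat)
  have strict: "r x < r y" if xy: "x \<in> carrier L" "y \<in> carrier L" "x \<sqsubset> y" for x y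
  proof -
    obtain C where C: "chain_of L C" "\<forall>z\<in>C. z \<sqsubseteq> x" "card C = r x" using Pr[of x] by (auto simp: P_def)
    have Cc: "C \<subseteq> carrier L" using C(1) by (simp add: chain_of_def)
    have le: "z \<sqsubseteq> y" if "z \<in> C" for z
      using that C(2) xy Cc by (meson le_trans lless_eq subsetD)
    have "y \<notin> C" using C(2) xy by (auto simp: lless_eq)
    then have "card (insert y C) = Suc (r x)" using C bound[OF C(1)] by simp
    moreover have "chain_of L (insert y C)"
      using C(1) le xy(2) by (auto simp: chain_of_def Complete_Partial_Order.chain_def)
    ultimately have "P y (Suc (r x))" using le xy(2)
      unfolding P_def by (intro exI[of _ "insert y C"]) auto
    then show ?thesis using le_r by fastforce
  qed
  have "ranked_order L r (Suc N)"
    by unfold_locales (auto intro: strict Ple[OF Pr])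
  then show ?thesis by blast
qed

end

section \<open>The height function of a semimodular lattice\<close>

locale finite_length_semimodular = lattice L for L (structure) +
  assumes nonempty: "carrier L \<noteq> {}"
    and semimodular: "\<lbrakk>a \<in> carrier L; b \<in> carrier L; covered_by L (a \<sqinter> b) a\<rbrakk>
                        \<Longrightarrow> covered_by L b (a \<squnion> b)"
    and finite_length: "finite_length L"
begin

lemma meet_glb: "\<lbrakk>x \<in> carrier L; y \<in> carrier L; z \<in> carrier L\<rbrakk> \<Longrightarrow> z \<sqsubseteq> x \<sqinter> y \<longleftrightarrow> z \<sqsubseteq> x \<and> z \<sqsubseteq> y"
  using meet_left[of x y] meet_right[of x y] meet_le[of z x y] meet_closed[of x y]
    le_trans[of z "x \<sqinter> y" x] le_trans[of z "x \<sqinter> y" y] by blast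

lemma join_lub: "\<lbrakk>x \<in> carrier L; y \<in> carrier L; z \<in> carrier L\<rbrakk> \<Longrightarrow> x \<squnion> y \<sqsubseteq> z \<longleftrightarrow> x \<sqsubseteq> z \<and> y \<sqsubseteq> z"
  using join_left[of x y] join_right[of x y] join_le[of x z y] join_closed[of x y]
    le_trans[of x "x \<squnion> y" z] le_trans[of y "x \<squnion> y" z] by blast

lemma exists_cover_above: "\<lbrakk>x \<in> carrier L; y \<in> carrier L; x \<sqsubset> y\<rbrakk> \<Longrightarrow> \<exists>z. covered_by L x z \<and> z \<sqsubseteq> y"
  using finite_length_ranked[OF finite_length] ranked_order.exists_cover_above[of L _ _ x y] by auto

lemma exists_cover_below: "\<lbrakk>x \<in> carrier L; y \<in> carrier L; x \<sqsubset> y\<rbrakk> \<Longrightarrow> \<exists>z. covered_by L z y \<and> x \<sqsubseteq> z"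
  using finite_length_ranked[OF finite_length] ranked_order.exists_cover_below[of L _ _ x y] by auto

lemma exists_cover_steps:
  assumes "x \<in> carrier L" "y \<in> carrier L" "x \<sqsubseteq> y"
  shows "\<exists>n. cover_steps L n x y"
proof -
  obtain r N where "ranked_order L r N" using finite_length_ranked[OF finite_length] by blast
  then interpret ranked_order L r N .
  show ?thesis using assms
  proof (induction "N - r x" arbitrary: x rule: less_induct)
    case less
    show ?case
    proof (cases "x = y")
      case True then show ?thesis using less.prems cover_steps.refl[of x L] by auto
    next
      case False
      then obtain z where z: "covered_by L x z" "z \<sqsubseteq> y"
        using exists_cover_above[of x y] less.prems lless_eq[of x y] by blast
      note xz = covered_byD[OF z(1)]
      have "r x < r z" using rank_strict[of x z] xz by (simp add: lless_eq)
      moreover have "r z \<le> N" using rank_le[of z] xz by simp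
      ultimately obtain n where "cover_steps L n z y"
        using less.hyps[of z] z xz less.prems by (metis diff_less_mono2 less_le_trans)
      then show ?thesis using cover_steps.step[OF z(1)] by blast
    qed
  qed
qed

text \<open>Jordan--Dedekind: two different covers \<open>x'\<close> and \<open>y'\<close> of the lower end are both covered by
  their join, and a cover chain through this join compares the two given ones.\<close>

lemma cover_steps_unique:
  assumes "cover_steps L n x z" "cover_steps L m x z"
  shows "n = m"
  using assms
proof (induction n arbitrary: x m rule: less_induct)
  case (less n)
  show ?case
  proof (cases "x = z")
    case True
    have no: False if "cover_steps L (Suc k) z z" for k
      using that
    proof cases
      case (step y)
      note D = covered_byD[OF step(1)]
      show False using cover_steps_le[OF step(2)] D le_antisym[of z y] by simp
    qed
    show ?thesis using less.prems no True by (cases n; cases m) auto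
  next
    case False
    obtain n' x' where n: "n = Suc n'" "covered_by L x x'" "cover_steps L n' x' z"
      using less.prems(1) False by (auto elim: cover_steps.cases)
    obtain m' y' where m: "m = Suc m'" "covered_by L x y'" "cover_steps L m' y' z"
      using less.prems(2) False by (auto elim: cover_steps.cases)
    note X = covered_byD[OF n(2)] and Y = covered_byD[OF m(2)]
    show ?thesis
    proof (cases "x' = y'")
      case True
      then show ?thesis using less.IH[of n' x' m'] n m by auto
    next
      case False
      have zc: "z \<in> carrier L" using cover_steps_carrier[OF n(3)] by blast
      have mt: "x' \<sqinter> y' = x"
      proof -
        have "x \<sqsubseteq> x' \<sqinter> y'" using X Y by (simp add: meet_glb)
        moreover have "x' \<sqinter> y' \<noteq> x'"
        proof
          assume "x' \<sqinter> y' = x'"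
          then have "x' \<sqsubseteq> y'" using X(2) Y(2) meet_right[of x' y'] by simp
          then show False using covered_by_between[OF m(2), of x'] X False by auto
        qed
        ultimately show ?thesis using covered_by_between[OF n(2), of "x' \<sqinter> y'"] X(2) Y(2) meet_left by auto
      qed
      have cy: "covered_by L y' (x' \<squnion> y')"
        using semimodular[of x' y'] mt n X Y by simp
      have cx: "covered_by L x' (x' \<squnion> y')"
        using semimodular[of y' x'] mt m X Y by (simp add: meet_comm join_comm)
      have "x' \<squnion> y' \<sqsubseteq> z"
        using cover_steps_le n(3) m(3) X Y zc by (simp add: join_lub)
      then obtain k where k: "cover_steps L k (x' \<squnion> y') z"
        using exists_cover_steps[of "x' \<squnion> y'" z] X Y zc by auto
      have "n' = Suc k" using less.IH[of n' x' "Suc k"] n cover_steps.step[OF cx k] by auto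
      moreover have "Suc k = m'"
        using less.IH[of "Suc k" y' m'] n \<open>n' = Suc k\<close> cover_steps.step[OF cy k] m by auto
      ultimately show ?thesis using n m by simp
    qed
  qed
qed

lemma bounds:
  obtains b t where "b \<in> carrier L" "\<And>x. x \<in> carrier L \<Longrightarrow> b \<sqsubseteq> x"
    "t \<in> carrier L" "\<And>x. x \<in> carrier L \<Longrightarrow> x \<sqsubseteq> t"
proof -
  obtain r N where "ranked_order L r N" using finite_length_ranked[OF finite_length] by blast
  then interpret ranked_order L r N .
  obtain c where c: "c \<in> carrier L" using nonempty by blast
  obtain b where b: "b \<in> carrier L" "\<And>w. w \<in> carrier L \<Longrightarrow> r b \<le> r w"
    using ex_has_least_nat[of "\<lambda>x. x \<in> carrier L" c r] c by blast
  obtain t where t: "t \<in> carrier L" "\<And>w. w \<in> carrier L \<Longrightarrow> r w \<le> r t"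
    using ex_has_greatest_nat[of "\<lambda>x. x \<in> carrier L" c r "Suc N"] c rank_le le_imp_less_Suc by blast
  have "b \<sqsubseteq> x" if "x \<in> carrier L" for x
    using rank_strict[of "b \<sqinter> x" b] b that meet_left[of b x] meet_right[of b x]
    by (metis leD lless_eq meet_closed)
  moreover have "x \<sqsubseteq> t" if "x \<in> carrier L" for x
    using rank_strict[of t "t \<squnion> x"] t that join_left[of t x] join_right[of t x]
    by (metis leD lless_eq join_closed)
  ultimately show thesis using that b t by blast
qed

sublocale bounded_lattice L
proof -
  obtain b t where bt: "b \<in> carrier L" "\<And>x. x \<in> carrier L \<Longrightarrow> b \<sqsubseteq> x"
    "t \<in> carrier L" "\<And>x. x \<in> carrier L \<Longrightarrow> x \<sqsubseteq> t" using bounds by blast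
  have "least L b (carrier L)" "greatest L t (carrier L)"
    unfolding least_def greatest_def using bt by auto
  then show "bounded_lattice L"
    by unfold_locales (rule exI, assumption)+
qed

definition height :: "'a \<Rightarrow> nat" where
  "height x = (THE n. cover_steps L n \<bottom> x)"

lemma cover_steps_height:
  assumes "x \<in> carrier L"
  shows "cover_steps L (height x) \<bottom> x"
  unfolding height_def
proof (rule theI')
  show "\<exists>!n. cover_steps L n \<bottom> x"
  proof (rule ex_ex1I)
    show "\<exists>n. cover_steps L n \<bottom> x"
      using assms by (intro exists_cover_steps) auto
  qed (rule cover_steps_unique)
qed

lemma height_eqI: "cover_steps L n \<bottom> x \<Longrightarrow> height x = n"
  using cover_steps_unique[OF cover_steps_height, of x n] cover_steps_carrier[of L n \<bottom> x] by blast

lemma height_bottom [simp]: "height \<bottom> = 0"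
  by (rule height_eqI) (simp add: cover_steps.refl)

lemma height_cover: "covered_by L x y \<Longrightarrow> height y = Suc (height x)"
  by (rule height_eqI, rule cover_steps_append, rule cover_steps_height) (auto dest: covered_byD)

lemma height_cover_steps: "cover_steps L n x y \<Longrightarrow> height y = height x + n"
  by (induction rule: cover_steps.induct) (auto simp: height_cover)

lemma height_mono: "\<lbrakk>x \<in> carrier L; y \<in> carrier L; x \<sqsubseteq> y\<rbrakk> \<Longrightarrow> height x \<le> height y"
  using exists_cover_steps[of x y] height_cover_steps[of _ x y] by auto

lemma height_strict:
  assumes "x \<in> carrier L" "y \<in> carrier L" "x \<sqsubset> y"
  shows "height x < height y"
proof -
  obtain z where z: "covered_by L x z" "z \<sqsubseteq> y" using exists_cover_above[OF assms] by blast
  then show ?thesis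
    using height_cover[OF z(1)] height_mono[OF covered_byD(2)[OF z(1)] assms(2) z(2)] by simp
qed

lemma height_eq_imp_eq: "\<lbrakk>x \<in> carrier L; y \<in> carrier L; x \<sqsubseteq> y; height y \<le> height x\<rbrakk> \<Longrightarrow> x = y"
  using height_strict[of x y] by (auto simp: lless_eq)

sublocale ranked_order L height "height \<top>"
  by unfold_locales (auto intro: height_mono height_strict)

lemma poset_length_eq_height: "poset_length L = enat (height \<top>)"
  using cover_steps_chain[OF cover_steps_height[OF top_closed]] poset_length_eq by auto

text \<open>Joining with \<open>b\<close> takes a cover to a cover or to an equality, since \<open>y \<sqinter> (b \<squnion> x)\<close> lies
  between \<open>x\<close> and \<open>y\<close>. Carried along a cover chain from \<open>a \<sqinter> b\<close> to \<open>a\<close>, this gives the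
  submodularity of the height.\<close>

lemma height_join_cover:
  assumes "covered_by L x y" "b \<in> carrier L"
  shows "height (b \<squnion> y) \<le> Suc (height (b \<squnion> x))"
proof -
  note X = covered_byD[OF assms(1)]
  let ?c = "b \<squnion> x"
  have c: "?c \<in> carrier L" using X assms by simp
  have j: "y \<squnion> ?c = b \<squnion> y"
  proof (rule le_antisym)
    have "x \<sqsubseteq> b \<squnion> y"
      using X assms join_right[of b y] le_trans[of x y "b \<squnion> y"] by simp
    then show "y \<squnion> ?c \<sqsubseteq> b \<squnion> y"
      using X assms c join_left[of b y] join_right[of b y] by (simp add: join_lub)
    have "b \<sqsubseteq> y \<squnion> ?c"
      using X assms c join_left[of b x] join_right[of y ?c] le_trans[of b ?c "y \<squnion> ?c"] by simp
    then show "b \<squnion> y \<sqsubseteq> y \<squnion> ?c"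
      using X assms c join_left[of y ?c] by (simp add: join_lub)
  qed (use X assms c in auto)
  have "x \<sqsubseteq> y \<sqinter> ?c" using X assms by (simp add: meet_glb join_right)
  then consider "y \<sqinter> ?c = x" | "y \<sqinter> ?c = y" using covered_by_between[OF assms(1), of "y \<sqinter> ?c"] X c meet_left by auto
  then show ?thesis
  proof cases
    case 1
    then show ?thesis using semimodular[of y ?c] assms X c j height_cover[of ?c "b \<squnion> y"] by simp
  next
    case 2
    then have "y \<sqsubseteq> ?c" using X c meet_right[of y ?c] by simp
    then have "b \<squnion> y \<sqsubseteq> ?c" using X assms c by (simp add: join_lub join_left)
    then show ?thesis using height_mono[of "b \<squnion> y" ?c] X assms c by simp
  qed
qed

lemma height_join_cover_steps:
  assumes "cover_steps L n x y" "b \<in> carrier L"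
  shows "height (b \<squnion> y) \<le> height (b \<squnion> x) + n"
  using assms
proof (induction rule: cover_steps.induct)
  case (step x y n z)
  then show ?case using height_join_cover[of x y b] by simp
qed simp

lemma height_submodular:
  assumes "a \<in> carrier L" "b \<in> carrier L"
  shows "height (a \<squnion> b) + height (a \<sqinter> b) \<le> height a + height b"
proof -
  obtain n where n: "cover_steps L n (a \<sqinter> b) a"
    using exists_cover_steps[of "a \<sqinter> b" a] assms meet_left by auto
  have "b \<squnion> (a \<sqinter> b) = b"
    using assms meet_right[of a b] le_iff_meet[of "a \<sqinter> b" b] by (simp add: join_comm)
  then show ?thesis
    using height_cover_steps[OF n] height_join_cover_steps[OF n assms(2)] by (simp add: join_comm)
qed

end

section \<open>Join-irreducible elements\<close>

lemma J_le [simp]: "le (J M) = le M"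
  by (simp add: J_def)

context finite_length_semimodular
begin

definition below :: "'a \<Rightarrow> 'a set" where
  "below a = {x \<in> carrier (J L). x \<sqsubseteq> a}"

lemma J_closed: "x \<in> carrier (J L) \<Longrightarrow> x \<in> carrier L"
  by (simp add: J_def)

lemma J_lower_cover:
  assumes "x \<in> carrier (J L)"
  obtains p where "covered_by L p x" "\<And>z. \<lbrakk>z \<in> carrier L; z \<sqsubseteq> x; z \<noteq> x\<rbrakk> \<Longrightarrow> z \<sqsubseteq> p"
proof -
  obtain p where p: "covered_by L p x" "\<And>y. covered_by L y x \<Longrightarrow> y = p"
    using assms by (auto simp: J_def)
  moreover have "z \<sqsubseteq> p" if "z \<in> carrier L" "z \<sqsubseteq> x" "z \<noteq> x" for z
    using exists_cover_below[of z x] p(2) that J_closed[OF assms] lless_eq[of z x] by blast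
  ultimately show thesis using that by blast
qed

lemma J_height_pos: "x \<in> carrier (J L) \<Longrightarrow> 0 < height x"
  by (metis J_lower_cover height_cover zero_less_Suc)

lemma below_subset_J: "below a \<subseteq> carrier (J L)"
  by (auto simp: below_def)

lemma below_mono: "\<lbrakk>a \<in> carrier L; b \<in> carrier L; a \<sqsubseteq> b\<rbrakk> \<Longrightarrow> below a \<subseteq> below b"
  using le_trans[of _ a b] by (auto simp: below_def J_closed)

lemma below_meet: "\<lbrakk>a \<in> carrier L; b \<in> carrier L\<rbrakk> \<Longrightarrow> below (a \<sqinter> b) = below a \<inter> below b"
  by (auto simp: below_def J_closed meet_glb)

lemma below_join_supset: "\<lbrakk>a \<in> carrier L; b \<in> carrier L\<rbrakk> \<Longrightarrow> below a \<union> below b \<subseteq> below (a \<squnion> b)"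
  using below_mono[of a "a \<squnion> b"] below_mono[of b "a \<squnion> b"] join_left[of a b] join_right[of a b]
  by simp

lemma below_bottom: "below \<bottom> = {}"
proof -
  have "False" if "x \<in> carrier (J L)" "x \<sqsubseteq> \<bottom>" for x
    using height_mono[of x \<bottom>] J_height_pos[of x] that by (simp add: J_closed)
  then show ?thesis by (auto simp: below_def)
qed

lemma below_top: "below \<top> = carrier (J L)"
  by (auto simp: below_def J_closed)

text \<open>An element of least height below \<open>a\<close> but not below \<open>c\<close> is join-irreducible: two lower
  covers would both lie below \<open>c\<close>, and their join is the element itself.\<close>

lemma le_if_below_subset:
  assumes "a \<in> carrier L" "c \<in> carrier L" "below a \<subseteq> below c"
  shows "a \<sqsubseteq> c"
proof (rule ccontr)
  assume nle: "\<not> a \<sqsubseteq> c"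
  define P where "P z \<longleftrightarrow> z \<in> carrier L \<and> z \<sqsubseteq> a \<and> \<not> z \<sqsubseteq> c" for z
  have "P a" using assms nle by (simp add: P_def)
  then obtain x where x: "P x" and min: "\<And>w. P w \<Longrightarrow> height x \<le> height w"
    using ex_has_least_nat[of P a height] by blast
  have xc: "x \<in> carrier L" "x \<sqsubseteq> a" "\<not> x \<sqsubseteq> c" using x by (auto simp: P_def)
  have low: "y \<sqsubseteq> c" if y: "covered_by L y x" for y
  proof (rule ccontr)
    assume "\<not> y \<sqsubseteq> c"
    then have "P y" using covered_byD[OF y] xc assms le_trans[of y x a] by (simp add: P_def)
    then show False using min[of y] height_cover[OF y] by simp
  qed
  have "x \<noteq> \<bottom>" using xc assms by auto
  then obtain p where p: "covered_by L p x"
    using exists_cover_below[of \<bottom> x] xc by (auto simp: lless_eq)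
  note pD = covered_byD[OF p]
  have "q = p" if q: "covered_by L q x" for q
  proof (rule ccontr)
    assume ne: "q \<noteq> p"
    note qD = covered_byD[OF q]
    have "q \<squnion> p \<sqsubseteq> x" "q \<sqsubseteq> q \<squnion> p" "q \<squnion> p \<sqsubseteq> c"
      using pD qD xc assms low p q by (simp_all add: join_lub join_left)
    then have "q \<squnion> p = q" using covered_by_between[OF q, of "q \<squnion> p"] xc pD qD by auto
    then have "p \<sqsubseteq> q" using join_right[of q p] pD qD by simp
    then show False using covered_by_between[OF p, of q] qD ne by auto
  qed
  then have "x \<in> carrier (J L)" using p xc by (auto simp: J_def)
  then have "x \<in> below c" using assms xc by (auto simp: below_def)
  then show False using xc by (simp add: below_def)
qed

text \<open>Joining to \<open>c\<close> a join-irreducible \<open>x\<close> of least height in \<open>S - below c\<close> raises the height by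
  at most one, as the lower cover of \<open>x\<close> is already below \<open>c\<close>.\<close>

lemma height_le_height_plus_card:
  assumes "S \<subseteq> carrier (J L)" and "\<And>x y. \<lbrakk>x \<in> S; y \<in> below x\<rbrakk> \<Longrightarrow> y \<in> S"
    and "a \<in> carrier L" and "\<And>d. \<lbrakk>d \<in> carrier L; S \<subseteq> below d\<rbrakk> \<Longrightarrow> a \<sqsubseteq> d"
    and "c \<in> carrier L" and "finite (S - below c)"
  shows "height a \<le> height c + card (S - below c)"
  using assms(5,6)
proof (induction "card (S - below c)" arbitrary: c rule: less_induct)
  case less
  show ?case
  proof (cases "S \<subseteq> below c")
    case True
    then show ?thesis using height_mono[of a c] assms(3,4) less.prems by (simp add: trans_le_add1)
  next
    case False
    then obtain x0 where "x0 \<in> S - below c" by blast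
    from ex_has_least_nat[of "\<lambda>x. x \<in> S - below c", OF this, of height]
    obtain x where x: "x \<in> S - below c"
      and min: "\<forall>w. w \<in> S - below c \<longrightarrow> height x \<le> height w" by (elim exE conjE)
    have xJ: "x \<in> carrier (J L)" using x assms(1) by blast
    then have xc: "x \<in> carrier L" by (rule J_closed)
    obtain p where p: "covered_by L p x" by (rule J_lower_cover[OF xJ])
    note pD = covered_byD[OF p]
    have "below p \<subseteq> below c"
    proof
      fix y assume y: "y \<in> below p"
      then have yp: "y \<in> carrier L" "y \<sqsubseteq> p" by (auto simp: below_def J_closed)
      have "y \<in> S" using y below_mono[of p x] pD assms(2)[of x y] x by auto
      moreover have "height y < height x"
        using height_mono[of y p] yp pD height_cover[OF p] by simp
      ultimately show "y \<in> below c" using min by (metis DiffI leD)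
    qed
    then have "p \<sqsubseteq> c" using le_if_below_subset pD less.prems by simp
    then have "c \<squnion> p = c" using le_iff_meet[of p c] pD less.prems by (simp add: join_comm)
    then have hc: "height (c \<squnion> x) \<le> Suc (height c)"
      using height_join_cover[OF p less.prems(1)] by simp
    have "x \<in> below (c \<squnion> x)" using xJ xc less.prems join_right[of c x] by (simp add: below_def)
    then have sub: "S - below (c \<squnion> x) \<subset> S - below c"
      using below_join_supset[of c x] x xc less.prems by blast
    have fin: "finite (S - below (c \<squnion> x))" using sub less.prems finite_subset by blast
    have lt: "card (S - below (c \<squnion> x)) < card (S - below c)"
      using sub less.prems by (simp add: psubset_card_mono)
    have "height a \<le> height (c \<squnion> x) + card (S - below (c \<squnion> x))"
      using less.hyps[OF lt _ fin] less.prems xc by simp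
    then show ?thesis using hc lt by simp
  qed
qed

lemma chain_below_card_le:
  assumes "chain_of (J L) Z" "Z \<subseteq> below a" "a \<in> carrier L"
  shows "finite Z" "card Z \<le> height a"
proof -
  have Z: "chain_of L Z" using assms(1) by (auto simp: chain_of_def J_def)
  have "height ` Z \<subseteq> {0<..height a}"
    using assms(2,3) J_height_pos height_mono[of _ a] by (auto simp: below_def J_closed)
  then have "card (height ` Z) \<le> card {0<..height a}" by (intro card_mono) auto
  then show "card Z \<le> height a" by (simp add: card_image rank_inj_on_chain[OF Z])
  show "finite Z" by (rule chain_finite[OF Z])
qed

text \<open>If the largest element of \<open>Z\<close> is not \<open>a\<close>, the height of that element bounds the size of
  \<open>Z\<close>. If it is, then \<open>a\<close> is join-irreducible, and passing to its lower cover removes only \<open>a\<close>.\<close>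

lemma chain_below_card_less:
  assumes "chain_of (J L) Z" "Z \<subseteq> below a" "a \<in> carrier L" "y \<in> below a" "y \<notin> Z"
  shows "card Z < height a"
  using assms
proof (induction "height a" arbitrary: a Z rule: less_induct)
  case less
  have y: "y \<in> carrier (J L)" "y \<in> carrier L" "y \<sqsubseteq> a"
    using less.prems by (auto simp: below_def J_closed)
  have fin: "finite Z" using chain_below_card_le less.prems by blast
  show ?case
  proof (cases "Z = {}")
    case True
    then show ?thesis using J_height_pos[OF y(1)] height_mono[of y a] y less.prems by simp
  next
    case False
    then have "Max (height ` Z) \<in> height ` Z" using fin by simp
    then obtain z where z: "z \<in> Z" and eq: "Max (height ` Z) = height z" by auto
    have max: "height w \<le> height z" if "w \<in> Z" for w
      unfolding eq[symmetric] using that fin by simp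
    have zJ: "z \<in> carrier (J L)" "z \<in> carrier L" "z \<sqsubseteq> a"
      using z less.prems by (auto simp: below_def J_closed)
    have wz: "w \<sqsubseteq> z" "w \<in> carrier (J L)" if w: "w \<in> Z" for w
    proof -
      show wJ: "w \<in> carrier (J L)" using w less.prems by (auto simp: below_def)
      have "w \<sqsubseteq> z \<or> z \<sqsubseteq> w"
        using less.prems(1) w z by (auto simp: chain_of_def J_def Complete_Partial_Order.chain_def)
      then show "w \<sqsubseteq> z"
        using height_eq_imp_eq[of z w] max[OF w] zJ J_closed[OF wJ] by auto
    qed
    then have Zz: "Z \<subseteq> below z" by (auto simp: below_def)
    show ?thesis
    proof (cases "z = a")
      case False
      then have "height z < height a" using height_strict[of z a] zJ less.prems by (simp add: lless_eq)
      then show ?thesis using chain_below_card_le[OF less.prems(1) Zz zJ(2)] by simp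
    next
      case True
      then have aJ: "a \<in> carrier (J L)" using zJ by simp
      obtain p where p: "covered_by L p a"
        and le_p: "\<And>w. \<lbrakk>w \<in> carrier L; w \<sqsubseteq> a; w \<noteq> a\<rbrakk> \<Longrightarrow> w \<sqsubseteq> p"
        using J_lower_cover[OF aJ] by blast
      have "chain_of (J L) (Z - {a})"
        using less.prems(1) by (auto simp: chain_of_def Complete_Partial_Order.chain_def)
      moreover have "Z - {a} \<subseteq> below p" using wz le_p True by (auto simp: below_def J_closed)
      moreover have "y \<in> below p" using y le_p less.prems z True by (auto simp: below_def)
      ultimately have "card (Z - {a}) < height p"
        using less.hyps[of p "Z - {a}"] height_cover[OF p] covered_byD[OF p] less.prems(5) by simp
      then show ?thesis using height_cover[OF p] z True fin by (simp add: card_Diff_singleton)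
    qed
  qed
qed

end

section \<open>The rank of a downset of a disjoint union of chains\<close>

locale chain_partition = finite_length_semimodular L for L (structure) +
  fixes I :: "'i set" and C :: "'i \<Rightarrow> 'a set"
  assumes chains: "i \<in> I \<Longrightarrow> chain_of (J L) (C i)"
    and disjoint: "\<lbrakk>i \<in> I; j \<in> I; i \<noteq> j\<rbrakk> \<Longrightarrow> C i \<inter> C j = {}"
    and cover: "carrier (J L) = (\<Union>i\<in>I. C i)"
begin

text \<open>Only comparabilities within a single chain \<open>C i\<close> count here: these are the order ideals of
  the disjoint union of the chains, a weaker order on the join-irreducibles than that of \<open>L\<close>.\<close>

definition downset :: "'a set \<Rightarrow> bool" where
  "downset X \<longleftrightarrow> X \<subseteq> carrier (J L) \<and>
     (\<forall>i\<in>I. \<forall>x\<in>C i. \<forall>y\<in>C i. x \<sqsubseteq> y \<longrightarrow> y \<in> X \<longrightarrow> x \<in> X)"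

text \<open>The minimum is over those \<open>a\<close> for which the cardinality is honest; without finiteness
  \<open>card\<close> would be \<open>0\<close> and the value meaningless. The top element always qualifies.\<close>

definition rk :: "'a set \<Rightarrow> nat" where
  "rk X = (LEAST n. \<exists>a\<in>carrier L. finite (X - below a) \<and> n = height a + card (X - below a))"

definition attains :: "'a set \<Rightarrow> 'a \<Rightarrow> bool" where
  "attains X a \<longleftrightarrow> a \<in> carrier L \<and> finite (X - below a) \<and> rk X = height a + card (X - below a)"

lemma downset_subset_J: "downset X \<Longrightarrow> X \<subseteq> carrier (J L)"
  by (simp add: downset_def)

lemma downset_Un: "\<lbrakk>downset X; downset Y\<rbrakk> \<Longrightarrow> downset (X \<union> Y)"
  unfolding downset_def by blast

lemma downset_Int: "\<lbrakk>downset X; downset Y\<rbrakk> \<Longrightarrow> downset (X \<inter> Y)"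
  unfolding downset_def by blast

lemma downset_below: "a \<in> carrier L \<Longrightarrow> downset (below a)"
  using cover le_trans[of _ _ a] unfolding downset_def below_def by (blast intro: J_closed)

lemma rk_le: "\<lbrakk>a \<in> carrier L; finite (X - below a)\<rbrakk> \<Longrightarrow> rk X \<le> height a + card (X - below a)"
  unfolding rk_def by (rule Least_le) blast

lemma exists_attains:
  assumes "X \<subseteq> carrier (J L)"
  shows "\<exists>a. attains X a"
proof -
  have "finite (X - below \<top>)" using assms by (simp add: below_top Diff_eq_empty_iff[THEN iffD2])
  then have "\<exists>n. \<exists>a\<in>carrier L. finite (X - below a) \<and> n = height a + card (X - below a)"
    by (intro exI bexI[of _ \<top>]) auto
  from LeastI_ex[OF this] show ?thesis unfolding attains_def rk_def by blast
qed

lemma rk_le_height_top: "X \<subseteq> carrier (J L) \<Longrightarrow> rk X \<le> height \<top>"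
  using rk_le[of \<top> X] by (simp add: below_top Diff_eq_empty_iff[THEN iffD2])

lemma rk_mono:
  assumes "X \<subseteq> Y" "Y \<subseteq> carrier (J L)"
  shows "rk X \<le> rk Y"
proof -
  obtain a where a: "attains Y a" using exists_attains assms by blast
  have sub: "X - below a \<subseteq> Y - below a" using assms by blast
  then have "finite (X - below a)" using a finite_subset by (auto simp: attains_def)
  then have "rk X \<le> height a + card (X - below a)" using rk_le a by (auto simp: attains_def)
  also have "\<dots> \<le> rk Y" using a sub by (auto simp: attains_def intro: card_mono)
  finally show ?thesis .
qed

lemma rk_insert:
  assumes "X \<subseteq> carrier (J L)"
  shows "rk (insert x X) \<le> Suc (rk X)"
proof -
  obtain a where a: "attains X a" using exists_attains assms by blast
  have sub: "insert x X - below a \<subseteq> insert x (X - below a)" by blast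
  have fin: "finite (insert x (X - below a))" using a by (simp add: attains_def)
  have "rk (insert x X) \<le> height a + card (insert x X - below a)"
    using rk_le a finite_subset[OF sub fin] by (simp add: attains_def)
  also have "\<dots> \<le> height a + card (insert x (X - below a))"
    using card_mono[OF fin sub] by simp
  also have "\<dots> \<le> Suc (rk X)"
    using card_insert_le_m1[of "Suc (card (X - below a))" "X - below a" x] a
    by (simp add: attains_def)
  finally show ?thesis .
qed

text \<open>A join-irreducible counted on the left is counted on the right at least as often, because
  \<open>below\<close> turns meets into intersections and \<open>below (a \<squnion> b)\<close> contains both \<open>below a\<close> and
  \<open>below b\<close>. With the submodularity of the height, this makes the rank submodular and the set of
  elements attaining the rank of \<open>X\<close> closed under joins.\<close>

lemma card_outside_submodular:
  assumes "a \<in> carrier L" "b \<in> carrier L" "finite (X - below a)" "finite (Y - below b)"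
  shows "finite (X \<union> Y - below (a \<squnion> b))" "finite (X \<inter> Y - below (a \<sqinter> b))"
    "card (X \<union> Y - below (a \<squnion> b)) + card (X \<inter> Y - below (a \<sqinter> b))
      \<le> card (X - below a) + card (Y - below b)"
proof -
  let ?A = "X - below a" and ?B = "Y - below b"
  let ?U = "X \<union> Y - below (a \<squnion> b)" and ?V = "X \<inter> Y - below (a \<sqinter> b)"
  have join: "below a \<subseteq> below (a \<squnion> b)" "below b \<subseteq> below (a \<squnion> b)"
    using below_join_supset[of a b] assms by auto
  have U: "?U \<subseteq> ?A \<union> ?B" using join by blast
  have V: "?V \<subseteq> ?A \<union> ?B" using below_meet[of a b] assms by auto
  show fU: "finite ?U" using U assms finite_subset by blast
  show fV: "finite ?V" using V assms finite_subset by blast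
  have "card ?U + card ?V = card (?U \<union> ?V) + card (?U \<inter> ?V)" by (rule card_Un_Int[OF fU fV])
  also have "\<dots> \<le> card (?A \<union> ?B) + card (?A \<inter> ?B)"
    using U V join assms by (intro add_mono card_mono) auto
  also have "\<dots> = card ?A + card ?B" using card_Un_Int[of ?A ?B] assms by simp
  finally show "card ?U + card ?V \<le> card ?A + card ?B" .
qed

lemma rk_submodular:
  assumes "X \<subseteq> carrier (J L)" "Y \<subseteq> carrier (J L)"
  shows "rk (X \<union> Y) + rk (X \<inter> Y) \<le> rk X + rk Y"
proof -
  obtain a b where "attains X a" "attains Y b"
    using exists_attains[OF assms(1)] exists_attains[OF assms(2)] by blast
  then have ab: "a \<in> carrier L" "b \<in> carrier L" "finite (X - below a)" "finite (Y - below b)"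
    "rk X = height a + card (X - below a)" "rk Y = height b + card (Y - below b)"
    by (auto simp: attains_def)
  note c = card_outside_submodular[OF ab(1-4)]
  have "rk (X \<union> Y) \<le> height (a \<squnion> b) + card (X \<union> Y - below (a \<squnion> b))"
    using rk_le[OF _ c(1)] ab by simp
  moreover have "rk (X \<inter> Y) \<le> height (a \<sqinter> b) + card (X \<inter> Y - below (a \<sqinter> b))"
    using rk_le[OF _ c(2)] ab by simp
  ultimately show ?thesis using c(3) height_submodular[OF ab(1,2)] ab(5,6) by linarith
qed

lemma attains_join:
  assumes "attains X a" "attains X b"
  shows "attains X (a \<squnion> b)"
proof -
  have ab: "a \<in> carrier L" "b \<in> carrier L" "finite (X - below a)" "finite (X - below b)"
    "rk X = height a + card (X - below a)" "rk X = height b + card (X - below b)"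
    using assms by (auto simp: attains_def)
  note c = card_outside_submodular[OF ab(1-4)]
  have "rk X \<le> height (a \<squnion> b) + card (X - below (a \<squnion> b))"
    using rk_le[of "a \<squnion> b" X] c(1) ab by simp
  moreover have "rk X \<le> height (a \<sqinter> b) + card (X - below (a \<sqinter> b))"
    using rk_le[of "a \<sqinter> b" X] c(2) ab by simp
  ultimately have "rk X = height (a \<squnion> b) + card (X - below (a \<squnion> b))"
    using c(3) height_submodular[OF ab(1,2)] ab(5,6) by simp
  then show ?thesis using c(1) ab by (simp add: attains_def)
qed

lemma exists_greatest_attains:
  assumes "X \<subseteq> carrier (J L)"
  obtains a where "attains X a" "\<And>b. attains X b \<Longrightarrow> b \<sqsubseteq> a"
proof -
  obtain a0 where "attains X a0" using exists_attains assms by blast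
  then obtain a where a: "attains X a" and max: "\<And>b. attains X b \<Longrightarrow> height b \<le> height a"
    using ex_has_greatest_nat[of "attains X" a0 height "Suc (height \<top>)"]
    by (auto simp: attains_def rank_le less_Suc_eq_le)
  have "b \<sqsubseteq> a" if b: "attains X b" for b
  proof -
    have car: "a \<in> carrier L" "b \<in> carrier L" using a b by (auto simp: attains_def)
    have "a = a \<squnion> b"
      using height_eq_imp_eq[of a "a \<squnion> b"] max[OF attains_join[OF a b]] car join_left[of a b] by simp
    then show ?thesis using join_right[of a b] car by simp
  qed
  then show thesis using that a by blast
qed

end

section \<open>The lattice of closed downsets\<close>

context chain_partition
begin

text \<open>The analogue, for downsets, of a flat of a matroid.\<close>

definition rank_closed :: "'a set \<Rightarrow> bool" where
  "rank_closed X \<longleftrightarrow> downset X \<and> (\<forall>Y. downset Y \<longrightarrow> X \<subset> Y \<longrightarrow> rk X < rk Y)"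

lemma rank_closed_downset: "rank_closed X \<Longrightarrow> downset X"
  by (simp add: rank_closed_def)

lemma closed_rk_strict: "\<lbrakk>rank_closed X; downset Y; X \<subset> Y\<rbrakk> \<Longrightarrow> rk X < rk Y"
  by (simp add: rank_closed_def)

text \<open>With \<open>a\<close> the greatest element attaining the rank of \<open>X\<close>, the closure of \<open>X\<close> is
  \<open>X \<union> below a\<close>: an element attaining the rank of a larger set of the same rank attains that
  of \<open>X\<close> as well.\<close>

lemma exists_closure:
  assumes "downset X"
  shows "\<exists>Z. rank_closed Z \<and> X \<subseteq> Z \<and> rk Z = rk X"
proof -
  have XJ: "X \<subseteq> carrier (J L)" using assms by (rule downset_subset_J)
  obtain a where a: "attains X a" and great: "\<And>b. attains X b \<Longrightarrow> b \<sqsubseteq> a"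
    using exists_greatest_attains[OF XJ] by metis
  have ac: "a \<in> carrier L" "finite (X - below a)" "rk X = height a + card (X - below a)"
    using a by (auto simp: attains_def)
  let ?Z = "X \<union> below a"
  have dZ: "downset ?Z" using downset_Un[OF assms downset_below[OF ac(1)]] .
  have eq: "?Z - below a = X - below a" by blast
  have "rk ?Z \<le> rk X" using rk_le[of a ?Z] ac unfolding eq by simp
  moreover have "rk X \<le> rk ?Z" by (rule rk_mono) (use downset_subset_J[OF dZ] in auto)
  ultimately have rkZ: "rk ?Z = rk X" by simp
  have "rk ?Z < rk Y" if Y: "downset Y" "?Z \<subset> Y" for Y
  proof (rule ccontr)
    assume "\<not> rk ?Z < rk Y"
    then have rkY: "rk Y \<le> rk X" using rkZ by simp
    obtain b where b: "attains Y b" using exists_attains[OF downset_subset_J[OF Y(1)]] by blast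
    then have bc: "b \<in> carrier L" "finite (Y - below b)" "rk Y = height b + card (Y - below b)"
      by (auto simp: attains_def)
    have sub: "X - below b \<subseteq> Y - below b" using Y by blast
    have fin: "finite (X - below b)" using finite_subset[OF sub bc(2)] .
    have le: "card (X - below b) \<le> card (Y - below b)" using card_mono[OF bc(2) sub] .
    have ge: "rk X \<le> height b + card (X - below b)" using rk_le[OF bc(1) fin] .
    have "attains X b" using bc fin le ge rkY by (simp add: attains_def)
    then have "below b \<subseteq> below a" using great ac bc by (intro below_mono)
    moreover have "X - below b = Y - below b"
      by (rule card_subset_eq[OF bc(2) sub]) (use le ge bc rkY in simp)
    ultimately show False using Y by blast
  qed
  then have "rank_closed ?Z" using dZ by (simp add: rank_closed_def)
  then show ?thesis using rkZ by blast
qed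

text \<open>If \<open>Z\<close> contains \<open>X\<close>, then \<open>Z \<inter> Y\<close> has rank at least that of \<open>X\<close>, hence that of \<open>Y\<close>, so
  by submodularity adjoining \<open>Y\<close> does not increase the rank of \<open>Z\<close>.\<close>

lemma closed_contains_closure:
  assumes "downset Y" "X \<subseteq> Y" "rk Y = rk X" "rank_closed Z" "X \<subseteq> Z"
  shows "Y \<subseteq> Z"
proof (rule ccontr)
  assume "\<not> Y \<subseteq> Z"
  then have ps: "Z \<subset> Z \<union> Y" by blast
  have YJ: "Y \<subseteq> carrier (J L)" and ZJ: "Z \<subseteq> carrier (J L)" and dZ: "downset Z"
    using assms downset_subset_J rank_closed_downset by auto
  have "rk X \<le> rk (Z \<inter> Y)" by (rule rk_mono) (use assms YJ in auto)
  moreover have "rk Z < rk (Z \<union> Y)"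
    by (rule closed_rk_strict[OF assms(4) downset_Un[OF dZ assms(1)] ps])
  ultimately show False using rk_submodular[OF ZJ YJ] assms(3) by simp
qed

lemma closed_Int:
  assumes "rank_closed X" "rank_closed Y"
  shows "rank_closed (X \<inter> Y)"
proof -
  have d: "downset (X \<inter> Y)" using assms by (intro downset_Int rank_closed_downset)
  obtain Z where Z: "rank_closed Z" "X \<inter> Y \<subseteq> Z" "rk Z = rk (X \<inter> Y)"
    using exists_closure[OF d] by blast
  have "Z \<subseteq> X" "Z \<subseteq> Y"
    using closed_contains_closure[OF rank_closed_downset[OF Z(1)] Z(2,3)] assms by auto
  then have "X \<inter> Y = Z" using Z by blast
  then show ?thesis using Z by simp
qed

text \<open>With \<open>a = b\<close> this says that \<open>below\<close> sends height to rank; in general it says that the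
  closure of \<open>below a \<union> below b\<close> is no smaller than \<open>below (a \<squnion> b)\<close>, so that \<open>below\<close>
  preserves joins.\<close>

lemma rk_below_Un:
  assumes "a \<in> carrier L" "b \<in> carrier L"
  shows "rk (below a \<union> below b) = height (a \<squnion> b)"
proof (rule antisym)
  have none: "below a \<union> below b - below (a \<squnion> b) = {}" using below_join_supset[OF assms] by blast
  show "rk (below a \<union> below b) \<le> height (a \<squnion> b)"
    using rk_le[of "a \<squnion> b" "below a \<union> below b"] assms unfolding none by simp
  obtain c where "attains (below a \<union> below b) c"
    using exists_attains[of "below a \<union> below b"] below_subset_J by auto
  then have c: "c \<in> carrier L" "finite (below a \<union> below b - below c)"
    "rk (below a \<union> below b) = height c + card (below a \<union> below b - below c)"
    by (auto simp: attains_def)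
  have "height (a \<squnion> b) \<le> height c + card (below a \<union> below b - below c)"
  proof (rule height_le_height_plus_card[OF _ _ _ _ c(1,2)])
    show "below a \<union> below b \<subseteq> carrier (J L)" using below_subset_J by simp
    show "y \<in> below a \<union> below b" if "x \<in> below a \<union> below b" "y \<in> below x" for x y
    proof -
      have "x \<in> carrier L" using that J_closed below_subset_J by blast
      then show ?thesis using that below_mono[of x a] below_mono[of x b] assms
        by (auto simp: below_def)
    qed
    show "a \<squnion> b \<in> carrier L" using assms by simp
    show "a \<squnion> b \<sqsubseteq> d" if "d \<in> carrier L" "below a \<union> below b \<subseteq> below d" for d
      using that assms le_if_below_subset[of a d] le_if_below_subset[of b d] by (simp add: join_lub)
  qed
  then show "height (a \<squnion> b) \<le> rk (below a \<union> below b)" using c by simp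
qed

lemma rk_below: "a \<in> carrier L \<Longrightarrow> rk (below a) = height a"
  using rk_below_Un[of a a] le_iff_meet[of a a] by simp

text \<open>Let \<open>b\<close> attain the rank of a larger downset \<open>Y\<close>, and let \<open>y \<in> Y\<close> be not below \<open>a\<close>. Replacing
  \<open>b\<close> by \<open>a \<sqinter> b\<close> changes nothing in \<open>below a - below b\<close>. It loses height if \<open>y\<close> is below \<open>b\<close>, and
  otherwise \<open>y\<close> itself adds one to the count for \<open>Y\<close>.\<close>

lemma closed_below:
  assumes "a \<in> carrier L"
  shows "rank_closed (below a)"
  unfolding rank_closed_def
proof (intro conjI allI impI)
  show "downset (below a)" using assms by (rule downset_below)
  fix Y assume Y: "downset Y" "below a \<subset> Y"
  then obtain y where y: "y \<in> Y" "y \<notin> below a" by blast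
  obtain b where "attains Y b" using exists_attains[OF downset_subset_J[OF Y(1)]] by blast
  then have b: "b \<in> carrier L" "finite (Y - below b)" "rk Y = height b + card (Y - below b)"
    by (auto simp: attains_def)
  let ?m = "a \<sqinter> b"
  have m: "?m \<in> carrier L" "?m \<sqsubseteq> b" using assms b meet_right by auto
  have sub: "below a - below ?m \<subseteq> Y - below b" using below_meet[OF assms b(1)] Y by blast
  then have fin: "finite (below a - below ?m)" using b finite_subset by blast
  have ge: "height a \<le> height ?m + card (below a - below ?m)"
    using rk_le[OF m(1) fin] rk_below[OF assms] by simp
  show "rk (below a) < rk Y"
  proof (cases "y \<in> below b")
    case True
    have "?m \<noteq> b"
    proof
      assume "?m = b"
      then show False using True y below_meet[OF assms b(1)] by auto
    qed
    then have "height ?m < height b" using height_strict[of ?m b] m b by (simp add: lless_eq)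
    moreover have "card (below a - below ?m) \<le> card (Y - below b)" using card_mono[OF b(2) sub] .
    ultimately show ?thesis using ge b rk_below[OF assms] by simp
  next
    case False
    then have "below a - below ?m \<subset> Y - below b" using sub y by blast
    then have "card (below a - below ?m) < card (Y - below b)" using b by (simp add: psubset_card_mono)
    moreover have "height ?m \<le> height b" using height_mono m b by simp
    ultimately show ?thesis using ge b rk_below[OF assms] by simp
  qed
qed

definition closed_sets :: "'a set gorder" where
  "closed_sets = \<lparr>carrier = {X. rank_closed X}, eq = (=), le = (\<subseteq>)\<rparr>"

lemma closed_sets_simps [simp]:
  "carrier closed_sets = {X. rank_closed X}" "eq closed_sets = (=)" "le closed_sets = (\<subseteq>)"
  by (simp_all add: closed_sets_def)

lemma lless_closed_sets [simp]: "X \<sqsubset>\<^bsub>closed_sets\<^esub> Y \<longleftrightarrow> X \<subset> Y"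
  by (auto simp: lless_def)

sublocale CL: partial_order closed_sets
  by unfold_locales auto

sublocale CL: ranked_order closed_sets rk "height \<top>"
  by unfold_locales
    (auto simp del: lless_closed_sets simp: rk_le_height_top downset_subset_J rank_closed_downset
      closed_rk_strict lless_closed_sets)

lemma least_closed_superset:
  assumes "rank_closed X" "rank_closed Y" "rank_closed Z" "X \<union> Y \<subseteq> Z" "rk Z = rk (X \<union> Y)"
  shows "least closed_sets Z (Upper closed_sets {X, Y})"
  using assms closed_contains_closure[OF rank_closed_downset[OF assms(3)] assms(4,5)]
  by (auto simp: least_def Upper_def)

lemma greatest_closed_subset:
  "\<lbrakk>rank_closed X; rank_closed Y\<rbrakk> \<Longrightarrow> greatest closed_sets (X \<inter> Y) (Lower closed_sets {X, Y})"
  by (auto simp: greatest_def Lower_def closed_Int)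

lemma exists_closure_Un:
  assumes "rank_closed X" "rank_closed Y"
  shows "\<exists>Z. rank_closed Z \<and> X \<union> Y \<subseteq> Z \<and> rk Z = rk (X \<union> Y)"
  using exists_closure[OF downset_Un[OF rank_closed_downset[OF assms(1)] rank_closed_downset[OF assms(2)]]] .

lemma lattice_closed_sets: "lattice closed_sets"
proof
  fix X Y assume "X \<in> carrier closed_sets" "Y \<in> carrier closed_sets"
  then have XY: "rank_closed X" "rank_closed Y" by auto
  show "\<exists>s. least closed_sets s (Upper closed_sets {X, Y})"
    using exists_closure_Un[OF XY] least_closed_superset[OF XY] by blast
  show "\<exists>s. greatest closed_sets s (Lower closed_sets {X, Y})"
    using greatest_closed_subset[OF XY] by blast
qed

lemma meet_closed_sets: "\<lbrakk>rank_closed X; rank_closed Y\<rbrakk> \<Longrightarrow> X \<sqinter>\<^bsub>closed_sets\<^esub> Y = X \<inter> Y"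
  by (intro CL.meet_eqI greatest_closed_subset)

lemma join_closed_setsI:
  "\<lbrakk>rank_closed X; rank_closed Y; rank_closed Z; X \<union> Y \<subseteq> Z; rk Z = rk (X \<union> Y)\<rbrakk> \<Longrightarrow> X \<squnion>\<^bsub>closed_sets\<^esub> Y = Z"
  by (intro CL.join_eqI least_closed_superset)

text \<open>Between closed sets \<open>X \<subset> Y\<close> there is always the closure of \<open>X\<close> with one more element, of
  rank one more than \<open>X\<close>. The element is taken of least height in \<open>Y - X\<close>, so that adjoining it
  leaves a downset.\<close>

lemma covered_by_closed_sets_iff:
  "covered_by closed_sets X Y \<longleftrightarrow> rank_closed X \<and> rank_closed Y \<and> X \<subset> Y \<and> rk Y = Suc (rk X)"
proof
  assume R: "rank_closed X \<and> rank_closed Y \<and> X \<subset> Y \<and> rk Y = Suc (rk X)"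
  have "\<not> (X \<subset> Z \<and> Z \<subset> Y)" if Z: "rank_closed Z" for Z
    using R Z closed_rk_strict[of X Z] closed_rk_strict[of Z Y] rank_closed_downset[of Z]
      rank_closed_downset[of Y] by (metis Suc_leI leD)
  then show "covered_by closed_sets X Y" using R by (auto simp: covered_by_def)
next
  assume L: "covered_by closed_sets X Y"
  then have XY: "rank_closed X" "rank_closed Y" "X \<subset> Y" by (auto simp: covered_by_def)
  note dX = rank_closed_downset[OF XY(1)] and dY = rank_closed_downset[OF XY(2)]
  obtain y0 where "y0 \<in> Y - X" using XY by blast
  from ex_has_least_nat[of "\<lambda>y. y \<in> Y - X", OF this, of height]
  obtain y where y: "y \<in> Y - X" and min: "\<forall>w. w \<in> Y - X \<longrightarrow> height y \<le> height w"
    by (elim exE conjE)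
  have yc: "y \<in> carrier L" using y downset_subset_J[OF dY] J_closed by blast
  have d: "downset (insert y X)"
    unfolding downset_def
  proof (intro conjI ballI impI)
    show "insert y X \<subseteq> carrier (J L)" using y downset_subset_J[OF dX] downset_subset_J[OF dY] by blast
    fix i u v assume uv: "i \<in> I" "u \<in> C i" "v \<in> C i" "u \<sqsubseteq> v" "v \<in> insert y X"
    show "u \<in> insert y X"
    proof (rule ccontr)
      assume u: "u \<notin> insert y X"
      have "v \<notin> X" using u uv dX unfolding downset_def by blast
      then have vy: "v = y" using uv by simp
      then have "u \<in> Y - X" using u uv dY y unfolding downset_def by blast
      moreover have "u \<in> carrier L" using cover uv J_closed by blast
      ultimately have "u = y" using height_eq_imp_eq[of u y] min yc uv vy by auto
      then show False using u by simp
    qed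
  qed
  obtain Z where Z: "rank_closed Z" "insert y X \<subseteq> Z" "rk Z = rk (insert y X)"
    using exists_closure[OF d] by blast
  have "Z \<subseteq> Y" using closed_contains_closure[OF rank_closed_downset[OF Z(1)] Z(2,3) XY(2)] y XY by blast
  then have "Z = Y" using CL.covered_by_between[OF L, of Z] Z y by auto
  moreover have "rk (insert y X) \<le> Suc (rk X)" using rk_insert downset_subset_J[OF dX] by blast
  ultimately show "rank_closed X \<and> rank_closed Y \<and> X \<subset> Y \<and> rk Y = Suc (rk X)"
    using XY Z closed_rk_strict[OF XY(1) dY XY(3)] by simp
qed

lemma semimodular_closed_sets: "semimodular_lattice closed_sets"
  unfolding semimodular_lattice_def
proof (intro conjI ballI impI)
  show "lattice closed_sets" by (rule lattice_closed_sets)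
  show "carrier closed_sets \<noteq> {}" using closed_below[OF bottom_closed] by auto
  fix X Y assume "X \<in> carrier closed_sets" "Y \<in> carrier closed_sets"
    and cov: "covered_by closed_sets (X \<sqinter>\<^bsub>closed_sets\<^esub> Y) X"
  then have XY: "rank_closed X" "rank_closed Y" by auto
  have c: "X \<inter> Y \<subset> X" "rk X = Suc (rk (X \<inter> Y))"
    using cov unfolding meet_closed_sets[OF XY] covered_by_closed_sets_iff by auto
  obtain Z where Z: "rank_closed Z" "X \<union> Y \<subseteq> Z" "rk Z = rk (X \<union> Y)"
    using exists_closure_Un[OF XY] by blast
  have "rk (X \<union> Y) + rk (X \<inter> Y) \<le> rk X + rk Y"
    using XY by (intro rk_submodular downset_subset_J rank_closed_downset)
  then have "rk Z \<le> Suc (rk Y)" using Z c by simp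
  moreover have "Y \<subset> Z" using Z c by blast
  moreover have "rk Y < rk Z" using closed_rk_strict[OF XY(2) rank_closed_downset[OF Z(1)]] \<open>Y \<subset> Z\<close> .
  ultimately show "covered_by closed_sets Y (X \<squnion>\<^bsub>closed_sets\<^esub> Y)"
    unfolding join_closed_setsI[OF XY Z] covered_by_closed_sets_iff using XY Z by simp
qed

lemma below_join:
  assumes "a \<in> carrier L" "b \<in> carrier L"
  shows "below a \<squnion>\<^bsub>closed_sets\<^esub> below b = below (a \<squnion> b)"
  using assms closed_below below_join_supset[OF assms] rk_below_Un[OF assms] rk_below[of "a \<squnion> b"]
  by (intro join_closed_setsI) auto

lemma below_inj_on: "inj_on below (carrier L)"
  by (rule inj_onI) (simp add: le_antisym le_if_below_subset)

lemma poset_length_closed_sets: "poset_length closed_sets = poset_length L"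
proof -
  obtain D where D: "chain_of L D" "card D = Suc (height \<top>)"
    using cover_steps_chain[OF cover_steps_height[OF top_closed]] by blast
  have Dc: "D \<subseteq> carrier L" using D by (simp add: chain_of_def)
  have "below x \<subseteq> below y \<or> below y \<subseteq> below x" if "x \<in> D" "y \<in> D" for x y
  proof -
    have "x \<sqsubseteq> y \<or> y \<sqsubseteq> x" "x \<in> carrier L" "y \<in> carrier L"
      using that D(1) Dc by (auto simp: chain_of_def Complete_Partial_Order.chain_def)
    then show ?thesis using below_mono by blast
  qed
  then have "chain_of closed_sets (below ` D)"
    using Dc by (auto simp: chain_of_def Complete_Partial_Order.chain_def intro: closed_below)
  moreover have "card (below ` D) = Suc (height \<top>)"
    using D(2) inj_on_subset[OF below_inj_on Dc] by (simp add: card_image)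
  ultimately show ?thesis using CL.poset_length_eq poset_length_eq_height by simp
qed

section \<open>The join-irreducible closed sets\<close>

lemma chain_le: "\<lbrakk>i \<in> I; x \<in> C i; y \<in> C i\<rbrakk> \<Longrightarrow> x \<sqsubseteq> y \<or> y \<sqsubseteq> x"
  using chains[of i] by (auto simp: chain_of_def Complete_Partial_Order.chain_def J_def)

lemma C_closed: "\<lbrakk>i \<in> I; x \<in> C i\<rbrakk> \<Longrightarrow> x \<in> carrier (J L)" "\<lbrakk>i \<in> I; x \<in> C i\<rbrakk> \<Longrightarrow> x \<in> carrier L"
  using cover J_closed by auto

text \<open>If \<open>a\<close> attains the rank of a set containing \<open>Z\<close>, then at most \<open>height a\<close> elements of \<open>Z\<close>
  lie below \<open>a\<close>, and fewer if some further join-irreducible does.\<close>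

lemma closed_initial_segment:
  assumes i: "i \<in> I" and Z: "Z \<subseteq> C i" and dn: "\<And>x y. \<lbrakk>x \<in> C i; y \<in> Z; x \<sqsubseteq> y\<rbrakk> \<Longrightarrow> x \<in> Z"
  shows "rank_closed Z" "finite Z" "rk Z = card Z"
proof -
  have ch: "chain_of (J L) W" if "W \<subseteq> Z" for W
    using that chains[OF i] Z
    unfolding chain_of_def Complete_Partial_Order.chain_def by (meson subset_iff)
  have ZJ: "Z \<subseteq> carrier (J L)" using ch[of Z] by (simp add: chain_of_def)
  show fin: "finite Z" using chain_below_card_le(1)[OF ch[of Z], of \<top>] ZJ by (simp add: below_top)
  have dZ: "downset Z"
    unfolding downset_def
  proof (intro conjI ballI impI)
    fix j x y assume xy: "j \<in> I" "x \<in> C j" "y \<in> C j" "x \<sqsubseteq> y" "y \<in> Z"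
    then have "j = i" using disjoint[of i j] i Z by blast
    then show "x \<in> Z" using dn xy by blast
  qed (rule ZJ)
  have split: "card Z = card (Z \<inter> below a) + card (Z - below a)" for a
    using fin by (metis card_Int_Diff)
  have ge: "card Z \<le> rk Y \<and> (Z \<noteq> Y \<longrightarrow> card Z < rk Y)" if Y: "Z \<subseteq> Y" "Y \<subseteq> carrier (J L)" for Y
  proof -
    obtain a where "attains Y a" using exists_attains[OF Y(2)] by blast
    then have a: "a \<in> carrier L" "finite (Y - below a)" "rk Y = height a + card (Y - below a)"
      by (auto simp: attains_def)
    have sub: "Z - below a \<subseteq> Y - below a" using Y by blast
    have le: "card (Z - below a) \<le> card (Y - below a)" using card_mono[OF a(2) sub] .
    have W: "card (Z \<inter> below a) \<le> height a"
      using chain_below_card_le(2)[OF ch[of "Z \<inter> below a"]] a by simp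
    have "card Z < rk Y" if ne: "Z \<noteq> Y"
    proof -
      obtain y where y: "y \<in> Y" "y \<notin> Z" using ne Y by blast
      show ?thesis
      proof (cases "y \<in> below a")
        case True
        then have "card (Z \<inter> below a) < height a"
          using chain_below_card_less[OF ch[of "Z \<inter> below a"], of a y] a y by simp
        then show ?thesis using le split[of a] a by simp
      next
        case False
        then have "Z - below a \<subset> Y - below a" using sub y by blast
        then have "card (Z - below a) < card (Y - below a)" using a by (simp add: psubset_card_mono)
        then show ?thesis using W split[of a] a by simp
      qed
    qed
    then show ?thesis using W le split[of a] a by simp
  qed
  have "rk Z \<le> card Z" using rk_le[of \<bottom> Z] fin by (simp add: below_bottom)
  then show rkZ: "rk Z = card Z" using ge[of Z] ZJ by simp
  show "rank_closed Z" unfolding rank_closed_def using dZ ge rkZ downset_subset_J by auto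
qed

definition initial :: "'i \<Rightarrow> 'a \<Rightarrow> 'a set" where
  "initial i x = {z \<in> C i. z \<sqsubseteq> x}"

lemma mem_initial: "\<lbrakk>i \<in> I; x \<in> C i\<rbrakk> \<Longrightarrow> x \<in> initial i x"
  using C_closed by (simp add: initial_def)

lemma initial_mono: "\<lbrakk>i \<in> I; x \<in> C i; y \<in> C i; x \<sqsubseteq> y\<rbrakk> \<Longrightarrow> initial i x \<subseteq> initial i y"
  using le_trans[of _ x y] C_closed(2)[of i] by (auto simp: initial_def)

lemma initial_inj_on: "i \<in> I \<Longrightarrow> inj_on (initial i) (C i)"
proof (rule inj_onI)
  fix x y assume xy: "i \<in> I" "x \<in> C i" "y \<in> C i" "initial i x = initial i y"
  then have "x \<in> initial i y" "y \<in> initial i x" using mem_initial[of i x] mem_initial[of i y] by auto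
  then show "x = y" using xy C_closed(2)[of i] by (auto simp: initial_def)
qed

lemma initial_subset_downset: "\<lbrakk>i \<in> I; x \<in> C i; downset X; x \<in> X\<rbrakk> \<Longrightarrow> initial i x \<subseteq> X"
  unfolding downset_def initial_def by blast

lemma closed_initial:
  assumes "i \<in> I" "x \<in> C i"
  shows "rank_closed (initial i x)" "rk (initial i x) = card (initial i x)" "finite (initial i x)"
proof -
  have sub: "initial i x \<subseteq> C i" by (auto simp: initial_def)
  have dn: "u \<in> initial i x" if "u \<in> C i" "v \<in> initial i x" "u \<sqsubseteq> v" for u v
    using that le_trans[of u v x] C_closed(2)[OF assms(1)] assms(2) by (auto simp: initial_def)
  show "rank_closed (initial i x)" "rk (initial i x) = card (initial i x)" "finite (initial i x)"
    using closed_initial_segment[OF assms(1) sub dn] by auto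
qed

text \<open>A closed set properly contained in the initial segment of \<open>x\<close> misses \<open>x\<close>, so removing \<open>x\<close>
  gives the only lower cover.\<close>

lemma initial_join_irreducible:
  assumes "i \<in> I" "x \<in> C i"
  shows "initial i x \<in> carrier (J closed_sets)"
proof -
  note P = closed_initial[OF assms] and x = mem_initial[OF assms]
  let ?D = "initial i x - {x}"
  have sub: "?D \<subseteq> C i" by (auto simp: initial_def)
  have dn: "u \<in> ?D" if "u \<in> C i" "v \<in> ?D" "u \<sqsubseteq> v" for u v
  proof -
    have v: "v \<in> C i" "v \<sqsubseteq> x" "v \<noteq> x" using that by (auto simp: initial_def)
    then have "u \<noteq> x" using that C_closed(2)[OF assms(1)] assms(2) le_antisym[of v x] by auto
    moreover have "u \<sqsubseteq> x" using that v C_closed(2)[OF assms(1)] assms(2) le_trans[of u v x] by auto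
    ultimately show ?thesis using that by (simp add: initial_def)
  qed
  have D: "rank_closed ?D" "rk ?D = card ?D"
    by (rule closed_initial_segment(1)[OF assms(1) sub], erule (2) dn)
      (rule closed_initial_segment(3)[OF assms(1) sub], erule (2) dn)
  have card: "card (initial i x) = Suc (card ?D)" using P(3) x by (metis card_Suc_Diff1)
  have rk: "rk (initial i x) = Suc (rk ?D)" by (simp only: P(2) D(2) card)
  have ps: "?D \<subset> initial i x" using x by blast
  have "covered_by closed_sets ?D (initial i x)"
    unfolding covered_by_closed_sets_iff by (intro conjI D(1) P(1) ps rk)
  moreover have "Y = ?D" if "covered_by closed_sets Y (initial i x)" for Y
  proof -
    have Y: "rank_closed Y" "Y \<subset> initial i x" "rk (initial i x) = Suc (rk Y)"
      using that unfolding covered_by_closed_sets_iff by auto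
    have "x \<notin> Y" using initial_subset_downset[OF assms rank_closed_downset[OF Y(1)]] Y by blast
    then have "Y \<subseteq> ?D" using Y by blast
    moreover have "\<not> Y \<subset> ?D" using closed_rk_strict[OF Y(1) rank_closed_downset[OF D(1)]] Y(3) rk by linarith
    ultimately show ?thesis by blast
  qed
  ultimately have "\<exists>!Y. covered_by closed_sets Y (initial i x)" by blast
  then show ?thesis using P(1) by (simp add: J_def)
qed

text \<open>Conversely, let \<open>Y\<close> be the only lower cover of \<open>X\<close> and \<open>x \<in> X - Y\<close>. If the initial segment
  of \<open>x\<close> were proper in \<open>X\<close>, it would lie below some lower cover, that is below \<open>Y\<close>.\<close>

lemma J_closed_sets: "carrier (J closed_sets) = (\<Union>i\<in>I. initial i ` C i)"
proof
  show "(\<Union>i\<in>I. initial i ` C i) \<subseteq> carrier (J closed_sets)"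
    using initial_join_irreducible by blast
  show "carrier (J closed_sets) \<subseteq> (\<Union>i\<in>I. initial i ` C i)"
  proof
    fix X assume "X \<in> carrier (J closed_sets)"
    then obtain Y where X: "rank_closed X" and Y: "covered_by closed_sets Y X"
      and uniq: "\<And>Z. covered_by closed_sets Z X \<Longrightarrow> Z = Y" by (auto simp: J_def)
    then obtain x where x: "x \<in> X" "x \<notin> Y" unfolding covered_by_closed_sets_iff by blast
    then obtain i where i: "i \<in> I" "x \<in> C i" using downset_subset_J[OF rank_closed_downset[OF X]] cover by blast
    have sub: "initial i x \<subseteq> X" using initial_subset_downset[OF i rank_closed_downset[OF X] x(1)] .
    have "initial i x = X"
    proof (rule ccontr)
      assume "initial i x \<noteq> X"
      then obtain Z where Z: "covered_by closed_sets Z X" "initial i x \<subseteq> Z"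
        using CL.exists_cover_below[of "initial i x" X] sub X closed_initial(1)[OF i] by auto
      then show False using uniq[OF Z(1)] x mem_initial[OF i] by blast
    qed
    then show "X \<in> (\<Union>i\<in>I. initial i ` C i)" using i by blast
  qed
qed

end

section \<open>Relabelling the elements of an order\<close>

locale relabelling = partial_order L for L (structure) +
  fixes f :: "'a \<Rightarrow> 'b"
  assumes inj: "inj_on f (carrier L)"
begin

abbreviation Q :: "'b gorder" where "Q \<equiv> copy f L"

lemma copy_carrier [simp]: "carrier Q = f ` carrier L"
  and copy_eq [simp]: "eq Q = (=)"
  by (simp_all add: copy_def)

lemma copy_le [simp]: "\<lbrakk>x \<in> carrier L; y \<in> carrier L\<rbrakk> \<Longrightarrow> f x \<sqsubseteq>\<^bsub>Q\<^esub> f y \<longleftrightarrow> x \<sqsubseteq> y"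
  using inj by (auto simp: copy_def dest: inj_onD)

lemma copy_inj_iff [simp]: "\<lbrakk>x \<in> carrier L; y \<in> carrier L\<rbrakk> \<Longrightarrow> f x = f y \<longleftrightarrow> x = y"
  using inj by (rule inj_on_eq_iff)

sublocale Q: partial_order Q
  by unfold_locales (auto intro: le_trans)

lemma copy_lless: "\<lbrakk>x \<in> carrier L; y \<in> carrier L\<rbrakk> \<Longrightarrow> f x \<sqsubset>\<^bsub>Q\<^esub> f y \<longleftrightarrow> x \<sqsubset> y"
  by (simp add: lless_eq Q.lless_eq)

lemma copy_covered_by:
  "\<lbrakk>x \<in> carrier L; y \<in> carrier L\<rbrakk> \<Longrightarrow> covered_by Q (f x) (f y) \<longleftrightarrow> covered_by L x y"
  by (auto simp: covered_by_def copy_lless)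

lemma copy_J: "carrier (J Q) = f ` carrier (J L)"
proof -
  have iff: "(\<exists>!v. covered_by Q v (f x)) \<longleftrightarrow> (\<exists>!y. covered_by L y x)" if x: "x \<in> carrier L" for x
  proof
    assume "\<exists>!v. covered_by Q v (f x)"
    then obtain v where v: "covered_by Q v (f x)" "\<And>w. covered_by Q w (f x) \<Longrightarrow> w = v" by auto
    obtain y where y: "y \<in> carrier L" "v = f y" using v(1) by (auto simp: covered_by_def)
    show "\<exists>!y. covered_by L y x"
    proof
      show "covered_by L y x" using v(1) y x copy_covered_by[of y x] by simp
      fix z assume z: "covered_by L z x"
      then have "z \<in> carrier L" by (rule covered_byD)
      then show "z = y" using v(2)[of "f z"] z y x copy_covered_by[of z x] by simp
    qed
  next
    assume "\<exists>!y. covered_by L y x"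
    then obtain y where y: "covered_by L y x" "\<And>z. covered_by L z x \<Longrightarrow> z = y" by auto
    have yc: "y \<in> carrier L" using y(1) by (rule covered_byD)
    show "\<exists>!v. covered_by Q v (f x)"
    proof
      show "covered_by Q (f y) (f x)" using y(1) x yc copy_covered_by[of y x] by simp
      fix w assume w: "covered_by Q w (f x)"
      then obtain z where z: "z \<in> carrier L" "w = f z" by (auto simp: covered_by_def)
      then show "w = f y" using y(2)[of z] w x copy_covered_by[of z x] by simp
    qed
  qed
  show ?thesis by (simp add: J_def Compr_image_eq iff cong: conj_cong)
qed

lemma copy_chain_of: "A \<subseteq> carrier L \<Longrightarrow> chain_of Q (f ` A) \<longleftrightarrow> chain_of L A"
  by (auto simp: chain_of_def Complete_Partial_Order.chain_def subset_iff)

lemma copy_poset_length: "poset_length Q = poset_length L"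
proof -
  have chains: "{B. chain_of Q B} = (`) f ` {A. chain_of L A}"
  proof (intro equalityI subsetI)
    fix B assume "B \<in> {B. chain_of Q B}"
    then have B: "chain_of Q B" "B \<subseteq> f ` carrier L" by (auto simp: chain_of_def)
    then obtain A where "A \<subseteq> carrier L" "B = f ` A" by (auto simp: subset_image_iff)
    then show "B \<in> (`) f ` {A. chain_of L A}" using B copy_chain_of by auto
  next
    fix B assume "B \<in> (`) f ` {A. chain_of L A}"
    then obtain A where A: "chain_of L A" "B = f ` A" by auto
    then have "A \<subseteq> carrier L" by (simp add: chain_of_def)
    then show "B \<in> {B. chain_of Q B}" using A copy_chain_of by simp
  qed
  have "(if finite (f ` A) then enat (card (f ` A) - 1) else \<infinity>)
      = (if finite A then enat (card A - 1) else \<infinity>)" if "chain_of L A" for A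
  proof -
    have "inj_on f A" using that inj inj_on_subset by (auto simp: chain_of_def)
    then show ?thesis by (simp add: card_image finite_image_iff)
  qed
  then show ?thesis unfolding poset_length_def chains image_image by (intro SUP_cong) auto
qed

end

locale lattice_relabelling = relabelling L f + lattice L for L (structure) and f
begin

lemma copy_least:
  "\<lbrakk>x \<in> carrier L; y \<in> carrier L\<rbrakk> \<Longrightarrow> least Q (f (x \<squnion> y)) (Upper Q {f x, f y})"
proof -
  assume xy: "x \<in> carrier L" "y \<in> carrier L"
  then have "Upper Q {f x, f y} = f ` {u \<in> carrier L. x \<sqsubseteq> u \<and> y \<sqsubseteq> u}"
    by (auto simp: Upper_def)
  then show ?thesis using xy by (auto simp: least_def join_left join_right join_le)
qed

lemma copy_greatest:
  "\<lbrakk>x \<in> carrier L; y \<in> carrier L\<rbrakk> \<Longrightarrow> greatest Q (f (x \<sqinter> y)) (Lower Q {f x, f y})"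
proof -
  assume xy: "x \<in> carrier L" "y \<in> carrier L"
  then have "Lower Q {f x, f y} = f ` {u \<in> carrier L. u \<sqsubseteq> x \<and> u \<sqsubseteq> y}"
    by (auto simp: Lower_def)
  then show ?thesis using xy by (auto simp: greatest_def meet_left meet_right meet_le)
qed

lemma copy_lattice: "lattice Q"
  by unfold_locales (auto intro: copy_least copy_greatest)

lemma copy_join: "\<lbrakk>x \<in> carrier L; y \<in> carrier L\<rbrakk> \<Longrightarrow> f x \<squnion>\<^bsub>Q\<^esub> f y = f (x \<squnion> y)"
  by (intro Q.join_eqI copy_least)

lemma copy_meet: "\<lbrakk>x \<in> carrier L; y \<in> carrier L\<rbrakk> \<Longrightarrow> f x \<sqinter>\<^bsub>Q\<^esub> f y = f (x \<sqinter> y)"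
  by (intro Q.meet_eqI copy_greatest)

lemma copy_semimodular:
  assumes "semimodular_lattice L"
  shows "semimodular_lattice Q"
  using assms copy_lattice
  by (auto simp: semimodular_lattice_def copy_meet copy_join copy_covered_by)

end

section \<open>The extension\<close>

theorem theorem6p1:
  fixes L :: "'a gorder" and C :: "'i \<Rightarrow> 'a set" and I :: "'i set"
  assumes "semimodular_lattice L" and "finite_length L"
    and "\<And>i. i \<in> I \<Longrightarrow> chain_of (J L) (C i)"
    and "\<And>i j. i \<in> I \<Longrightarrow> j \<in> I \<Longrightarrow> i \<noteq> j \<Longrightarrow> C i \<inter> C j = {}"
    and "carrier (J L) = (\<Union>i\<in>I. C i)"
  shows "\<exists>(K :: ('a + 'a set) gorder) (C' :: 'i \<Rightarrow> ('a + 'a set) set).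
           length_preserving_semimodular_extension (copy Inl L) K \<and>
           (\<forall>i\<in>I. chain_of (J K) (C' i)) \<and>
           (\<forall>i\<in>I. \<forall>j\<in>I. i \<noteq> j \<longrightarrow> parallel (J K) (C' i) (C' j)) \<and>
           carrier (J K) = (\<Union>i\<in>I. C' i) \<and>
           (\<forall>i\<in>I. C' i \<approx> C i)"
proof -
  interpret lattice L using assms(1) by (simp add: semimodular_lattice_def)
  interpret chain_partition L I C
    by unfold_locales (use assms in \<open>auto simp: semimodular_lattice_def\<close>)
  \<comment> \<open>The label \<open>Inl a\<close> on the closed set \<open>below a\<close> makes the copy of \<open>L\<close> a sublattice on the
    nose.\<close>
  define \<psi> :: "'a set \<Rightarrow> 'a + 'a set" where
    "\<psi> X = (if X \<in> below ` carrier L then Inl (the_inv_into (carrier L) below X) else Inr X)" for X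
  have \<psi>_below: "\<psi> (below a) = Inl a" if "a \<in> carrier L" for a
    using that below_inj_on by (simp add: \<psi>_def the_inv_into_f_f)
  have \<psi>_inj: "inj \<psi>"
  proof (rule injI)
    fix X Y assume eq: "\<psi> X = \<psi> Y"
    show "X = Y"
    proof (cases "X \<in> below ` carrier L \<and> Y \<in> below ` carrier L")
      case True
      then show ?thesis using eq \<psi>_below by auto
    next
      case False
      then show ?thesis using eq by (auto simp: \<psi>_def split: if_splits)
    qed
  qed
  interpret LQ: lattice_relabelling L "Inl :: 'a \<Rightarrow> 'a + 'a set"
    by unfold_locales simp
  interpret CL: lattice closed_sets by (rule lattice_closed_sets)
  interpret KQ: lattice_relabelling closed_sets \<psi>
    by unfold_locales (rule inj_on_subset[OF \<psi>_inj subset_UNIV])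
  define K where "K = copy \<psi> closed_sets"
  define C' where "C' i = \<psi> ` initial i ` C i" for i
  have J_K: "carrier (J K) = (\<Union>i\<in>I. C' i)"
    unfolding K_def KQ.copy_J J_closed_sets C'_def by blast
  have K_le: "\<psi> (initial i x) \<sqsubseteq>\<^bsub>K\<^esub> \<psi> (initial j y) \<longleftrightarrow> initial i x \<subseteq> initial j y"
    if "i \<in> I" "x \<in> C i" "j \<in> I" "y \<in> C j" for i j x y
    unfolding K_def using that closed_initial(1) by simp
  have len: "poset_length K = poset_length L"
    unfolding K_def by (simp add: KQ.copy_poset_length poset_length_closed_sets)
  have join: "Inl x \<squnion>\<^bsub>K\<^esub> Inl y = Inl (x \<squnion>\<^bsub>L\<^esub> y)" and meet: "Inl x \<sqinter>\<^bsub>K\<^esub> Inl y = Inl (x \<sqinter>\<^bsub>L\<^esub> y)"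
    if xy: "x \<in> carrier L" "y \<in> carrier L" for x y
  proof -
    have c: "rank_closed (below x)" "rank_closed (below y)" using xy closed_below by auto
    show "Inl x \<squnion>\<^bsub>K\<^esub> Inl y = Inl (x \<squnion>\<^bsub>L\<^esub> y)"
      using KQ.copy_join[of "below x" "below y"] c xy
      by (simp add: K_def \<psi>_below below_join)
    show "Inl x \<sqinter>\<^bsub>K\<^esub> Inl y = Inl (x \<sqinter>\<^bsub>L\<^esub> y)"
      using KQ.copy_meet[of "below x" "below y"] c xy
      by (simp add: K_def \<psi>_below meet_closed_sets below_meet[symmetric])
  qed
  have "Inl a \<in> carrier K" if "a \<in> carrier L" for a
    using imageI[of "below a" "carrier closed_sets" \<psi>] that
    by (simp add: K_def \<psi>_below closed_below)
  then have "sublattice (copy Inl L) K"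
    using LQ.copy_lattice KQ.copy_lattice
    by (auto simp: sublattice_def join_pres_def meet_pres_def K_def[symmetric] join meet
        LQ.copy_join LQ.copy_meet)
  then have "length_preserving_semimodular_extension (copy Inl L) K"
    using KQ.copy_semimodular[OF semimodular_closed_sets] len assms(2)
    by (simp add: length_preserving_semimodular_extension_def K_def[symmetric] finite_length_def
        LQ.copy_poset_length)
  moreover have "chain_of (J K) (C' i)" if i: "i \<in> I" for i
    unfolding chain_of_def
  proof
    show "C' i \<subseteq> carrier (J K)" using J_K i by blast
    show "Complete_Partial_Order.chain (le (J K)) (C' i)"
    proof (rule chainI)
      fix u v assume "u \<in> C' i" "v \<in> C' i"
      then obtain x y where xy: "x \<in> C i" "y \<in> C i" "u = \<psi> (initial i x)" "v = \<psi> (initial i y)"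
        by (auto simp: C'_def)
      then show "u \<sqsubseteq>\<^bsub>J K\<^esub> v \<or> v \<sqsubseteq>\<^bsub>J K\<^esub> u"
        using chain_le[OF i xy(1,2)] initial_mono[OF i] K_le[OF i _ i] by auto
    qed
  qed
  moreover have "parallel (J K) (C' i) (C' j)" if ij: "i \<in> I" "j \<in> I" "i \<noteq> j" for i j
    unfolding parallel_def
  proof (intro ballI)
    fix u v assume "u \<in> C' i" "v \<in> C' j"
    then obtain x y where xy: "x \<in> C i" "y \<in> C j" "u = \<psi> (initial i x)" "v = \<psi> (initial j y)"
      by (auto simp: C'_def)
    have "initial i x \<inter> initial j y = {}" using disjoint[OF ij] by (auto simp: initial_def)
    then show "\<not> u \<sqsubseteq>\<^bsub>J K\<^esub> v \<and> \<not> v \<sqsubseteq>\<^bsub>J K\<^esub> u"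
      using mem_initial[of i x] mem_initial[of j y] K_le[of i x j y] K_le[of j y i x] ij xy by auto
  qed
  moreover have "C' i \<approx> C i" if "i \<in> I" for i
  proof -
    have "bij_betw (\<psi> \<circ> initial i) (C i) (C' i)"
      using initial_inj_on[OF that] inj_on_subset[OF \<psi>_inj subset_UNIV]
      unfolding bij_betw_def C'_def by (simp add: comp_inj_on image_comp)
    then show ?thesis unfolding eqpoll_def using bij_betw_the_inv_into by blast
  qed
  ultimately show ?thesis using J_K by blast
qed

end
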